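(* Let $M$ be the circle $\mathbb T^1=\mathbb R/\mathbb Z$ equipped with the Euclidean metric and let $V\in C^\infty(\mathbb T^1,(0,\infty))$ satisfy $\|V\|_{L^\infty(\mathbb T^1)}=1$. For an open set $\omega\subset\mathbb T^1$, the following two assertions are equivalent: 1. There is $T>0$ such that $(\omega,T)$ satisfies (GCC$_V^+$). 2. $\omega$ contains all critical points of $V$.
   Context: For a smooth real function $k$ on $T^*M$ (or on $T^*M$ minus the zero section), $\varphi^k_t$ denotes the flow of its Hamiltonian vector field $H_k=\sum_j \partial_{\xi_j}k\,\partial_{x_j}-\partial_{x_j}k\,\partial_{\xi_j}$ (canonical coordinates); $\pi_M:T^*M\to M$ is the canonical projection, $|\xi|_g$ the norm of a covector, $S^*M=\{(x,\xi)\in T^*M:\ |\xi|_g=1\}$, and $q(x,\xi):=\sqrt{|\xi|_g^2+V(x)}$ on $T^*M$. For an open set $\omega\subset M$ and $T>0$: - $(\omega,T)$ satisfies (GCC) if for every $\rho\in S^*M$ there is $t\in(0,T)$ with $\pi_M\circ\varphi_t^{|\xi|_g}(\rho)\in\omega$; - $(\omega,T)$ satisfies (GCC$_V$) if for every $\rho\in T^*M$ there is $t\in(0,T)$ with $\pi_M\circ\varphi_t^{q}(\rho)\in\omega$; - $(\omega,T)$ satisfies (GCC$_V^+$) if it satisfies both (GCC) and (GCC$_V$). *)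

theory Defs
  imports "HOL-Probability.Essential_Supremum"
begin

section \<open>The circle as the quotient of the reals by the integers\<close>

definition circle_rel :: "real \<Rightarrow> real \<Rightarrow> bool" where
  "circle_rel a b \<longleftrightarrow> a - b \<in> \<int>"

lemma equivp_circle_rel: "equivp circle_rel"
proof (rule equivpI)
  show "reflp circle_rel"
    by (simp add: reflp_def circle_rel_def)
  show "symp circle_rel"
  proof (rule sympI, unfold circle_rel_def)
    fix a b :: real
    assume "a - b \<in> \<int>"
    then show "b - a \<in> \<int>"
      using Ints_minus[of "a - b"] by simp
  qed
  show "transp circle_rel"
  proof (rule transpI, unfold circle_rel_def)
    fix a b c :: real
    assume "a - b \<in> \<int>" and "b - c \<in> \<int>"
    then show "a - c \<in> \<int>"
      using Ints_add[of "a - b" "b - c"] by simp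
  qed
qed

quotient_type circle = real / circle_rel
  morphisms rep_circle circ
  by (rule equivp_circle_rel)

instantiation circle :: ab_group_add
begin

lift_definition zero_circle :: circle is 0 .

lift_definition plus_circle :: "circle \<Rightarrow> circle \<Rightarrow> circle" is "(+)"
  unfolding circle_rel_def by (drule (1) Ints_add) (simp add: algebra_simps)

lift_definition uminus_circle :: "circle \<Rightarrow> circle" is uminus
  unfolding circle_rel_def by (drule Ints_minus) (simp add: algebra_simps)

lift_definition minus_circle :: "circle \<Rightarrow> circle \<Rightarrow> circle" is "(-)"
  unfolding circle_rel_def by (drule (1) Ints_diff) (simp add: algebra_simps)

instance
  by standard (transfer; simp add: circle_rel_def algebra_simps)+

end

instantiation circle :: topological_space
begin

definition open_circle :: "circle set \<Rightarrow> bool" where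
  "open_circle U \<longleftrightarrow> open (circ -` U)"

instance
  by standard (auto simp: open_circle_def vimage_Union)

end

definition circle_measure :: "circle measure" where
  "circle_measure = distr (restrict_space lborel {0..<1}) borel circ"

definition linf_norm :: "(circle \<Rightarrow> real) \<Rightarrow> ereal" where
  "linf_norm f = esssup circle_measure (\<lambda>x. ereal \<bar>f x\<bar>)"

section \<open>Calculus on the circle\<close>

definition smooth_circle :: "(circle \<Rightarrow> real) \<Rightarrow> bool" where
  "smooth_circle f \<longleftrightarrow> (\<forall>n a. ((deriv ^^ n) (\<lambda>s. f (circ s))) differentiable (at a))"

definition circle_deriv :: "(circle \<Rightarrow> real) \<Rightarrow> circle \<Rightarrow> real" where
  "circle_deriv f x = deriv (\<lambda>s. f (x + circ s)) 0"

definition critical_point :: "(circle \<Rightarrow> real) \<Rightarrow> circle \<Rightarrow> bool" where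
  "critical_point f x \<longleftrightarrow> circle_deriv f x = 0"

text \<open>Velocity at time \<open>t\<close> of a curve \<open>c\<close> on the circle, defined for times in \<open>S\<close>: the derivative
  of a real-valued lift of \<open>c\<close>.  The lift is only constrained near \<open>t\<close>, since a lift that is
  differentiable at \<open>t\<close> may be chosen arbitrarily away from \<open>t\<close>.\<close>

definition circle_velocity :: "(real \<Rightarrow> circle) \<Rightarrow> real \<Rightarrow> real \<Rightarrow> real set \<Rightarrow> bool" where
  "circle_velocity c v t S \<longleftrightarrow>
     (\<exists>\<theta>. (\<forall>s\<in>S. c s = circ (\<theta> s)) \<and> (\<theta> has_real_derivative v) (at t within S))"

section \<open>Hamiltonian flows on the cotangent bundle of the circle\<close>

text \<open>The translation-invariant coframe trivialises the cotangent bundle, so a covector is a pair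
  \<open>(x, \<xi>)\<close> of a base point and a real number.\<close>

type_synonym cotangent = "circle \<times> real"

definition ham_field :: "(cotangent \<Rightarrow> real) \<Rightarrow> cotangent \<Rightarrow> real \<times> real" where
  "ham_field k = (\<lambda>(x, \<xi>). (deriv (\<lambda>\<eta>. k (x, \<eta>)) \<xi>, - circle_deriv (\<lambda>y. k (y, \<xi>)) x))"

definition integral_curve ::
    "(cotangent \<Rightarrow> real) \<Rightarrow> cotangent set \<Rightarrow> real set \<Rightarrow> (real \<Rightarrow> cotangent) \<Rightarrow> bool" where
  "integral_curve k D S \<gamma> \<longleftrightarrow>
     (\<forall>t\<in>S. \<gamma> t \<in> D
       \<and> circle_velocity (\<lambda>s. fst (\<gamma> s)) (fst (ham_field k (\<gamma> t))) t S
       \<and> ((\<lambda>s. snd (\<gamma> s)) has_real_derivative snd (ham_field k (\<gamma> t))) (at t within S))"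

text \<open>\<open>ham_flow k D t \<rho>\<close> is the time-\<open>t\<close> value of the integral curve in \<open>D\<close>, the domain on which
  \<open>k\<close> is smooth, that starts at \<open>\<rho>\<close>.  Derivatives are taken within the time segment, so only
  existence of the trajectory up to time \<open>t\<close> is required; uniqueness makes the description definite.\<close>

definition ham_flow ::
    "(cotangent \<Rightarrow> real) \<Rightarrow> cotangent set \<Rightarrow> real \<Rightarrow> cotangent \<Rightarrow> cotangent" where
  "ham_flow k D t \<rho> =
     (THE p. \<exists>\<gamma>. integral_curve k D (closed_segment 0 t) \<gamma> \<and> \<gamma> 0 = \<rho> \<and> \<gamma> t = p)"

section \<open>Geometric control conditions\<close>

definition covector_norm :: "cotangent \<Rightarrow> real" where
  "covector_norm = (\<lambda>(x, \<xi>). \<bar>\<xi>\<bar>)"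

definition cosphere :: "cotangent set" where
  "cosphere = {\<rho>. covector_norm \<rho> = 1}"

definition zero_section :: "cotangent set" where
  "zero_section = {\<rho>. snd \<rho> = 0}"

definition q_symbol :: "(circle \<Rightarrow> real) \<Rightarrow> cotangent \<Rightarrow> real" where
  "q_symbol V \<rho> = sqrt ((covector_norm \<rho>)\<^sup>2 + V (fst \<rho>))"

definition GCC :: "circle set \<Rightarrow> real \<Rightarrow> bool" where
  "GCC \<omega> T \<longleftrightarrow>
     (\<forall>\<rho>\<in>cosphere. \<exists>t\<in>{0<..<T}. fst (ham_flow covector_norm (- zero_section) t \<rho>) \<in> \<omega>)"

definition GCC_V :: "(circle \<Rightarrow> real) \<Rightarrow> circle set \<Rightarrow> real \<Rightarrow> bool" where
  "GCC_V V \<omega> T \<longleftrightarrow> (\<forall>\<rho>. \<exists>t\<in>{0<..<T}. fst (ham_flow (q_symbol V) UNIV t \<rho>) \<in> \<omega>)"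

definition GCC_V_plus :: "(circle \<Rightarrow> real) \<Rightarrow> circle set \<Rightarrow> real \<Rightarrow> bool" where
  "GCC_V_plus V \<omega> T \<longleftrightarrow> GCC \<omega> T \<and> GCC_V V \<omega> T"

end

(* The energy q is conserved along its flow, so a trajectory of energy E solves the system
   x' = xi / E, xi' = - V'(x) / (2 E), which is globally Lipschitz.
   Over a critical point of V the zero covector is stationary, so the critical point has to lie in
   omega. Conversely, if omega contains the critical points, then |V'| >= c > 0 off omega. A
   trajectory of large energy moves with speed at least 1/2 and goes round the circle in time 2. On
   a trajectory of bounded energy that stays off omega, the momentum changes at a rate at least
   c / (2 E) in absolute value while being bounded by E, which bounds the time. *)

theory Submission
  imports Defs
begin

section \<open>Global solutions of Lipschitz differential equations\<close>

text \<open>The integrating factor \<open>exp (- (K * s))\<close> turns the differential inequality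
  into a nonpositive derivative, so the product cannot rise above its initial value 0.\<close>

lemma gronwall_zero:
  fixes D D' :: "real \<Rightarrow> real"
  assumes "0 \<le> t"
    and D: "\<And>s. s \<in> {0..t} \<Longrightarrow> (D has_real_derivative D' s) (at s within {0..t})"
    and le: "\<And>s. s \<in> {0..t} \<Longrightarrow> D' s \<le> K * D s"
    and "D 0 = 0"
  shows "D t \<le> 0"
proof -
  let ?F = "\<lambda>s. exp (- (K * s)) * D s"
  have "(?F has_derivative (\<lambda>h. (exp (- (K * s)) * (D' s - K * D s)) * h)) (at s within {0..t})"
    if "0 \<le> s" "s \<le> t" for s
  proof -
    have "(?F has_real_derivative exp (- (K * s)) * (D' s - K * D s)) (at s within {0..t})"
      using that by (auto intro!: derivative_eq_intros D simp: algebra_simps)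
    then show ?thesis
      by (simp add: has_field_derivative_def)
  qed
  from mvt_very_simple[OF \<open>0 \<le> t\<close> this] obtain s where s: "s \<in> {0..t}"
    and "?F t - ?F 0 = exp (- (K * s)) * (D' s - K * D s) * (t - 0)"
    by blast
  moreover have "exp (- (K * s)) * (D' s - K * D s) * (t - 0) \<le> 0"
    using le[OF s] \<open>0 \<le> t\<close> by (intro mult_nonpos_nonneg mult_nonneg_nonpos) auto
  ultimately have "?F t \<le> 0"
    using \<open>D 0 = 0\<close> by simp
  then show ?thesis
    by (simp add: mult_le_0_iff)
qed

text \<open>By Cauchy-Schwarz the squared distance \<open>D\<close> of two solutions satisfies
  \<open>D' \<le> 2 * L * D\<close>, and it starts at 0. Squaring keeps the distance differentiable
  where the solutions meet.\<close>

lemma lipschitz_ode_unique: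
  fixes f :: "'a::real_inner \<Rightarrow> 'a"
  assumes f: "L-lipschitz_on UNIV f" and "0 \<le> t"
    and x: "\<And>s. s \<in> {0..t} \<Longrightarrow> (x has_vector_derivative f (x s)) (at s within {0..t})"
    and y: "\<And>s. s \<in> {0..t} \<Longrightarrow> (y has_vector_derivative f (y s)) (at s within {0..t})"
    and init: "x 0 = y 0"
  shows "x t = y t"
proof -
  define D where "D s = (x s - y s) \<bullet> (x s - y s)" for s
  have "D t \<le> 0"
  proof (rule gronwall_zero[where D = D and K = "2 * L"])
    fix s assume s: "s \<in> {0..t}"
    have "((\<lambda>s. x s - y s) has_vector_derivative f (x s) - f (y s)) (at s within {0..t})"
      by (intro derivative_intros x y s)
    from bounded_bilinear.has_vector_derivative[OF bounded_bilinear_inner this this]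
    have "(D has_vector_derivative 2 * ((x s - y s) \<bullet> (f (x s) - f (y s)))) (at s within {0..t})"
      by (simp add: D_def[abs_def] inner_commute)
    then show "(D has_real_derivative 2 * ((x s - y s) \<bullet> (f (x s) - f (y s)))) (at s within {0..t})"
      by (simp add: has_real_derivative_iff_has_vector_derivative)
    have "(x s - y s) \<bullet> (f (x s) - f (y s)) \<le> norm (x s - y s) * norm (f (x s) - f (y s))"
      by (rule norm_cauchy_schwarz)
    also have "\<dots> \<le> norm (x s - y s) * (L * norm (x s - y s))"
      using lipschitz_onD[OF f, of "x s" "y s"] by (intro mult_left_mono) (auto simp: dist_norm)
    finally show "2 * ((x s - y s) \<bullet> (f (x s) - f (y s))) \<le> 2 * L * D s"
      by (simp add: D_def power2_norm_eq_inner[symmetric] power2_eq_square algebra_simps)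
  qed (use \<open>0 \<le> t\<close> init in \<open>auto simp: D_def\<close>)
  then show ?thesis
    by (simp add: D_def flip: power2_norm_eq_inner)
qed

section \<open>Existence by Picard iteration\<close>

primrec picard_iterate :: "('a::euclidean_space \<Rightarrow> 'a) \<Rightarrow> 'a \<Rightarrow> nat \<Rightarrow> real \<Rightarrow> 'a" where
  "picard_iterate f x0 0 t = x0"
| "picard_iterate f x0 (Suc n) t = x0 + integral {0..t} (\<lambda>s. f (picard_iterate f x0 n s))"

lemma continuous_on_picard_iterate:
  assumes "continuous_on UNIV f"
  shows "continuous_on {0..T} (picard_iterate f x0 n)"
proof (induction n)
  case (Suc n)
  then have "continuous_on {0..T} (\<lambda>s. f (picard_iterate f x0 n s))"
    using continuous_on_compose2[OF assms] by blast
  then have "continuous_on {0..T} (\<lambda>t. x0 + integral {0..t} (\<lambda>s. f (picard_iterate f x0 n s)))"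
    by (intro continuous_intros indefinite_integral_continuous_1 integrable_continuous_real)
  then show ?case
    by (subst continuous_on_cong[OF refl picard_iterate.simps(2)])
qed (simp add: continuous_on_const)

lemma has_integral_power_div_fact:
  fixes t :: real
  assumes "0 \<le> t"
  shows "((\<lambda>s. s ^ n / fact n) has_integral t ^ Suc n / fact (Suc n)) {0..t}"
proof -
  have "((\<lambda>s. s ^ n / fact n) has_integral t ^ Suc n / fact (Suc n) - 0 ^ Suc n / fact (Suc n)) {0..t}"
  proof (rule fundamental_theorem_of_calculus[OF assms])
    fix s :: real
    have "((\<lambda>s. s ^ Suc n / fact (Suc n)) has_real_derivative (real (Suc n) * s ^ n) / fact (Suc n))
        (at s within {0..t})"
      using DERIV_cdivide[OF DERIV_pow[of "Suc n" s "{0..t}"], of "fact (Suc n)"]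
      by (simp only: diff_Suc_Suc diff_zero)
    also have "(real (Suc n) * s ^ n) / fact (Suc n) = s ^ n / fact n"
      by (simp add: fact_Suc del: of_nat_Suc)
    finally show "((\<lambda>s. s ^ Suc n / fact (Suc n)) has_vector_derivative s ^ n / fact n)
        (at s within {0..t})"
      by (simp only: has_real_derivative_iff_has_vector_derivative)
  qed
  then show ?thesis
    by simp
qed

text \<open>Each iteration costs one factor \<open>L\<close> and one integration from 0 to
  \<open>t\<close>, and the integration turns \<open>s ^ Suc n / fact (Suc n)\<close> into the next
  term of the same kind.\<close>

lemma picard_iterate_diff_bound:
  assumes f: "L-lipschitz_on UNIV f" and "0 \<le> t"
  shows "norm (picard_iterate f x0 (Suc n) t - picard_iterate f x0 n t)
    \<le> norm (f x0) * L ^ n * (t ^ Suc n / fact (Suc n))"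
  using \<open>0 \<le> t\<close>
proof (induction n arbitrary: t)
  case 0
  then show ?case
    by (simp add: mult.commute)
next
  case (Suc n)
  have "0 \<le> L"
    using f by (rule lipschitz_on_nonneg)
  let ?\<phi> = "picard_iterate f x0"
  have int: "(\<lambda>s. f (?\<phi> m s)) integrable_on {0..t}" for m
    using continuous_on_compose2[OF lipschitz_on_continuous_on[OF f]
        continuous_on_picard_iterate[OF lipschitz_on_continuous_on[OF f]]]
    by (intro integrable_continuous_real) blast
  have hi: "((\<lambda>s. norm (f x0) * L ^ Suc n * (s ^ Suc n / fact (Suc n))) has_integral
      norm (f x0) * L ^ Suc n * (t ^ Suc (Suc n) / fact (Suc (Suc n)))) {0..t}"
    by (intro has_integral_mult_right has_integral_power_div_fact Suc.prems)
  have "?\<phi> (Suc (Suc n)) t - ?\<phi> (Suc n) t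
      = integral {0..t} (\<lambda>s. f (?\<phi> (Suc n) s) - f (?\<phi> n s))"
    using int[of "Suc n"] int[of n]
    by (subst integral_diff) (simp_all only: picard_iterate.simps add_diff_cancel_left)
  also have "norm \<dots> \<le> integral {0..t} (\<lambda>s. norm (f x0) * L ^ Suc n * (s ^ Suc n / fact (Suc n)))"
  proof (rule integral_norm_bound_integral)
    show "(\<lambda>s. f (?\<phi> (Suc n) s) - f (?\<phi> n s)) integrable_on {0..t}"
      by (intro integrable_diff int)
    show "(\<lambda>s. norm (f x0) * L ^ Suc n * (s ^ Suc n / fact (Suc n))) integrable_on {0..t}"
      using hi by blast
    fix s assume "s \<in> {0..t}"
    then have "norm (?\<phi> (Suc n) s - ?\<phi> n s) \<le> norm (f x0) * L ^ n * (s ^ Suc n / fact (Suc n))"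
      by (intro Suc.IH) simp
    then have "L * norm (?\<phi> (Suc n) s - ?\<phi> n s)
        \<le> L * (norm (f x0) * L ^ n * (s ^ Suc n / fact (Suc n)))"
      using \<open>0 \<le> L\<close> by (rule mult_left_mono)
    moreover have "norm (f (?\<phi> (Suc n) s) - f (?\<phi> n s)) \<le> L * norm (?\<phi> (Suc n) s - ?\<phi> n s)"
      using lipschitz_onD[OF f, of "?\<phi> (Suc n) s" "?\<phi> n s"] by (simp only: dist_norm UNIV_I)
    ultimately show "norm (f (?\<phi> (Suc n) s) - f (?\<phi> n s))
        \<le> norm (f x0) * L ^ Suc n * (s ^ Suc n / fact (Suc n))"
      by (simp only: power_Suc mult.assoc mult.left_commute)
  qed
  also have "\<dots> = norm (f x0) * L ^ Suc n * (t ^ Suc (Suc n) / fact (Suc (Suc n)))"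
    using hi by (rule integral_unique)
  finally show ?case .
qed

text \<open>The iterates are partial sums of a telescoping series that converges uniformly by the
  M-test. Since \<open>f\<close> is uniformly continuous, the limit may be taken under the integral;
  it satisfies the integral equation, which is then differentiated.\<close>

theorem lipschitz_ode_exists:
  fixes f :: "'a::euclidean_space \<Rightarrow> 'a"
  assumes f: "L-lipschitz_on UNIV f" and "0 \<le> T"
  obtains \<gamma> where "\<gamma> 0 = x0"
    and "\<And>t. t \<in> {0..T} \<Longrightarrow> (\<gamma> has_vector_derivative f (\<gamma> t)) (at t within {0..T})"
proof -
  have "0 \<le> L"
    using f by (rule lipschitz_on_nonneg)
  let ?\<phi> = "picard_iterate f x0"
  let ?a = "\<lambda>n t. ?\<phi> (Suc n) t - ?\<phi> n t"
  \<comment> \<open>With \<open>fact n\<close> in place of \<open>fact (Suc n)\<close> the majorant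
    is a constant times a term of the exponential series at \<open>L * T\<close>.\<close>
  define M where "M n = norm (f x0) * L ^ n * (T ^ Suc n / fact n)" for n
  have contf: "continuous_on UNIV f"
    using f by (rule lipschitz_on_continuous_on)
  have "summable M"
  proof -
    have "summable (\<lambda>n. norm (f x0) * T * (inverse (fact n) * (L * T) ^ n))"
      by (intro summable_mult summable_exp)
    then show ?thesis
      unfolding M_def by (simp add: power_mult_distrib divide_inverse mult_ac)
  qed
  have bound: "norm (?a n t) \<le> M n" if "t \<in> {0..T}" for n t
  proof -
    have "t ^ Suc n / fact (Suc n) \<le> T ^ Suc n / fact n"
      using that by (intro frac_le power_mono fact_mono) auto
    then have "norm (f x0) * L ^ n * (t ^ Suc n / fact (Suc n)) \<le> M n"
      unfolding M_def using \<open>0 \<le> L\<close> by (intro mult_left_mono) auto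
    with picard_iterate_diff_bound[OF f, of t x0 n] that show ?thesis
      by (metis atLeastAtMost_iff order.trans)
  qed
  have "uniform_limit {0..T} (\<lambda>n t. \<Sum>i<n. ?a i t) (\<lambda>t. \<Sum>i. ?a i t) sequentially"
    by (rule Weierstrass_m_test[OF bound \<open>summable M\<close>])
  then have "uniform_limit {0..T} (\<lambda>n t. x0 + (\<Sum>i<n. ?a i t)) (\<lambda>t. x0 + (\<Sum>i. ?a i t)) sequentially"
    by (intro uniform_limit_intros)
  moreover have "x0 + (\<Sum>i<n. ?a i t) = ?\<phi> n t" for n t
    using sum_lessThan_telescope[of "\<lambda>n. ?\<phi> n t" n] by simp
  moreover define \<gamma> where "\<gamma> = (\<lambda>t. x0 + (\<Sum>i. ?a i t))"
  ultimately have lim: "uniform_limit {0..T} ?\<phi> \<gamma> sequentially"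
    by (simp only:)
  have cont\<phi>: "continuous_on {0..t} (?\<phi> n)" for t n
    by (rule continuous_on_picard_iterate[OF contf])
  have limf: "uniform_limit {0..T} (\<lambda>n t. f (?\<phi> n t)) (\<lambda>t. f (\<gamma> t)) sequentially"
    using uniform_limit_compose[OF lim lipschitz_on_uniformly_continuous[OF f]]
    by (simp add: comp_def)
  have cont: "continuous_on {0..T} (\<lambda>t. f (\<gamma> t))"
  proof (rule uniform_limit_theorem[OF always_eventually limf], rule allI)
    show "continuous_on {0..T} (\<lambda>t. f (?\<phi> n t))" for n
      using continuous_on_compose2[OF contf cont\<phi>] by blast
  qed simp
  have eq: "\<gamma> t = x0 + integral {0..t} (\<lambda>s. f (\<gamma> s))" if t: "t \<in> {0..T}" for t
  proof -
    have "uniform_limit {0..t} (\<lambda>n t. f (?\<phi> n t)) (\<lambda>t. f (\<gamma> t)) sequentially"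
      using limf by (rule uniform_limit_on_subset) (use t in auto)
    moreover have "continuous_on {0..t} (\<lambda>t. f (?\<phi> n t))" for n
      using continuous_on_compose2[OF contf cont\<phi>] by blast
    ultimately obtain I J where I: "\<And>n. ((\<lambda>t. f (?\<phi> n t)) has_integral I n) {0..t}"
      and J: "((\<lambda>t. f (\<gamma> t)) has_integral J) {0..t}" and IJ: "I \<longlonglongrightarrow> J"
      by (rule uniform_limit_integral) auto
    have "(\<lambda>n. ?\<phi> (Suc n) t) \<longlonglongrightarrow> x0 + J"
      using tendsto_add[OF tendsto_const IJ, of x0] by (simp add: integral_unique[OF I])
    moreover have "(\<lambda>n. ?\<phi> (Suc n) t) \<longlonglongrightarrow> \<gamma> t"
      using tendsto_uniform_limitI[OF lim t] by (rule LIMSEQ_Suc)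
    ultimately show ?thesis
      using J LIMSEQ_unique by (metis integral_unique)
  qed
  show thesis
  proof
    show "\<gamma> 0 = x0"
      using eq[of 0] \<open>0 \<le> T\<close> by simp
    fix t assume t: "t \<in> {0..T}"
    have "((\<lambda>t. x0 + integral {0..t} (\<lambda>s. f (\<gamma> s))) has_vector_derivative 0 + f (\<gamma> t)) (at t within {0..T})"
      by (intro derivative_intros integral_has_vector_derivative[OF cont] t)
    then show "(\<gamma> has_vector_derivative f (\<gamma> t)) (at t within {0..T})"
      using has_vector_derivative_transform[OF t, of \<gamma>] eq by simp
  qed
qed

section \<open>Curves on the circle\<close>

lemma circ_eq_iff: "circ a = circ b \<longleftrightarrow> a - b \<in> \<int>"
  by (simp add: circle.abs_eq_iff circle_rel_def)

lemma circ_plus: "circ a + circ b = circ (a + b)"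
  by (rule plus_circle.abs_eq)

lemma circ_rep_circle: "circ (rep_circle x) = x"
  by (rule Quotient3_abs_rep[OF Quotient3_circle])

lemma circ_surj_01:
  obtains a where "0 \<le> a" "a \<le> 1" "x = circ a"
proof
  show "x = circ (frac (rep_circle x))"
    by (subst circ_rep_circle[symmetric], subst circ_eq_iff) (simp add: frac_def)
qed (use frac_lt_1[of "rep_circle x"] in auto)

text \<open>Passes from the translation-based derivative at 0 to the ordinary derivative of the
  periodic pull-back to the line, where calculus is available.\<close>

lemma circle_deriv_circ: "circle_deriv f (circ a) = deriv (\<lambda>s. f (circ s)) a"
  unfolding circle_deriv_def circ_plus by (subst (2) deriv_shift_0) (simp add: comp_def)

text \<open>The compact interval \<open>{0..1}\<close> meets every class, so a maximum there is a
  maximum on the circle. Raising it to at least 1 makes the bound positive.\<close>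

lemma continuous_circle_bounded_above:
  fixes f :: "circle \<Rightarrow> real"
  assumes "continuous_on UNIV (\<lambda>s. f (circ s))"
  obtains B where "B > 0" "\<And>x. f x \<le> B"
proof -
  have "continuous_on {0..1} (\<lambda>s. f (circ s))"
    using assms by (rule continuous_on_subset) simp
  from continuous_attains_sup[OF compact_Icc _ this]
  obtain m where le: "\<forall>s\<in>{0..1}. f (circ s) \<le> f (circ m)"
    by auto
  show thesis
  proof
    fix x
    obtain a where "0 \<le> a" "a \<le> 1" "x = circ a"
      by (rule circ_surj_01)
    then show "f x \<le> max 1 (f (circ m))"
      using le by (simp add: le_max_iff_disj)
  qed simp
qed

text \<open>Rolle's theorem on \<open>{0..1}\<close>, whose end points are the same point of the
  circle. Hence a set that contains all critical points is nonempty.\<close>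

lemma circle_critical_point_exists:
  assumes "\<And>s. (\<lambda>s. f (circ s)) differentiable (at s)"
  obtains x where "critical_point f x"
proof -
  have "circ 0 = circ 1"
    by (simp add: circ_eq_iff)
  moreover have "continuous_on {0..1} (\<lambda>s. f (circ s))"
    by (intro continuous_at_imp_continuous_on ballI differentiable_imp_continuous_within assms)
  ultimately obtain z where "((\<lambda>s. f (circ s)) has_real_derivative 0) (at z)"
    using Rolle[of 0 1 "\<lambda>s. f (circ s)"] assms by auto
  then have "critical_point f (circ z)"
    by (simp add: critical_point_def circle_deriv_circ DERIV_imp_deriv)
  then show thesis ..
qed

lemma has_real_derivative_zero_imp_eq:
  fixes f :: "real \<Rightarrow> real"
  assumes "\<And>x. x \<in> S \<Longrightarrow> (f has_real_derivative 0) (at x within S)"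
    and "convex S" "x \<in> S" "y \<in> S"
  shows "f x = f y"
  using has_field_derivative_zero_constant[OF assms(2,1)] assms(3,4) by metis

section \<open>Velocities and lifts of curves\<close>

lemma circle_velocityI:
  assumes "\<And>s. s \<in> S \<Longrightarrow> c s = circ (\<theta> s)"
    and "(\<theta> has_real_derivative v) (at t within S)"
  shows "circle_velocity c v t S"
  using assms unfolding circle_velocity_def by blast

text \<open>The lifts witnessing the velocity at different times need not agree. But the cosine of
  \<open>2\<pi>(\<theta> - X)\<close> does not depend on the lift \<open>\<theta>\<close>, and its derivative vanishes.\<close>

lemma circle_velocity_lift:
  assumes "convex S"
    and c: "\<And>t. t \<in> S \<Longrightarrow> circle_velocity c (v t) t S"
    and X: "\<And>t. t \<in> S \<Longrightarrow> (X has_real_derivative v t) (at t within S)"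
    and "t0 \<in> S" "c t0 = circ (X t0)" "t \<in> S"
  shows "c t = circ (X t)"
proof -
  define F where "F s = cos (2 * pi * (rep_circle (c s) - X s))" for s
  have F_eq: "F s = cos (2 * pi * (a - X s))" if "c s = circ a" for s a
  proof -
    have "rep_circle (c s) - a \<in> \<int>"
      using that circ_rep_circle[of "c s"] by (simp flip: circ_eq_iff)
    then obtain k :: int where "rep_circle (c s) = a + of_int k"
      by (elim Ints_cases) (simp add: algebra_simps)
    then have "F s = cos (2 * pi * (a - X s) + 2 * pi * of_int k)"
      by (simp add: F_def algebra_simps)
    then show ?thesis
      by (simp add: cos_add)
  qed
  have "(F has_real_derivative 0) (at s within S)" if s: "s \<in> S" for s
  proof -
    from c[OF s] obtain \<theta> where \<theta>: "\<And>r. r \<in> S \<Longrightarrow> c r = circ (\<theta> r)"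
      and d: "(\<theta> has_real_derivative v s) (at s within S)"
      unfolding circle_velocity_def by blast
    \<comment> \<open>At time \<open>s\<close> both \<open>\<theta>\<close> and \<open>X\<close>
      have derivative \<open>v s\<close>, so the argument of the cosine has derivative 0
      there.\<close>
    have "((\<lambda>r. cos (2 * pi * (\<theta> r - X r))) has_real_derivative 0) (at s within S)"
      by (auto intro!: derivative_eq_intros d X s)
    then show ?thesis
      unfolding has_field_derivative_def
      by (rule has_derivative_transform[OF s, rotated]) (use F_eq \<theta> in auto)
  qed
  then have "F t = F t0"
    by (rule has_real_derivative_zero_imp_eq[where S = S]) (use assms in auto)
  \<comment> \<open>At \<open>t0\<close> the real number \<open>X t0\<close> itself represents
    \<open>c t0\<close>, so the constant value of \<open>F\<close> is \<open>cos 0\<close>. A cosine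
    equal to 1 makes the representatives differ by an integer.\<close>
  then have "cos (2 * pi * (rep_circle (c t) - X t)) = 1"
    using F_eq[OF \<open>c t0 = circ (X t0)\<close>] by (simp add: F_def)
  then obtain n :: int where "2 * pi * (rep_circle (c t) - X t) = of_int n * 2 * pi"
    using cos_one_2pi_int by blast
  then have "rep_circle (c t) - X t = of_int n"
    by simp
  then show ?thesis
    by (metis Ints_of_int circ_eq_iff circ_rep_circle)
qed

text \<open>The lift that witnesses the velocity at the single time \<open>t\<close> suffices:
  \<open>f\<close> composed with the curve is the periodic pull-back of \<open>f\<close> composed
  with this lift.\<close>

lemma circle_velocity_chain:
  assumes c: "circle_velocity c v t S" and "t \<in> S"
    and f: "\<And>s. (\<lambda>s. f (circ s)) differentiable (at s)"
  shows "((\<lambda>s. f (c s)) has_real_derivative circle_deriv f (c t) * v) (at t within S)"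
proof -
  from c obtain \<theta> where \<theta>: "\<And>r. r \<in> S \<Longrightarrow> c r = circ (\<theta> r)"
    and d: "(\<theta> has_real_derivative v) (at t within S)"
    unfolding circle_velocity_def by blast
  have "((\<lambda>s. f (circ s)) has_real_derivative circle_deriv f (c t)) (at (\<theta> t))"
    using f[of "\<theta> t"] \<theta>[OF \<open>t \<in> S\<close>]
    by (simp add: circle_deriv_circ DERIV_deriv_iff_real_differentiable)
  from DERIV_chain2[OF this d]
  have "((\<lambda>s. f (circ (\<theta> s))) has_real_derivative circle_deriv f (c t) * v) (at t within S)" .
  then show ?thesis
    unfolding has_field_derivative_def
    by (rule has_derivative_transform[OF \<open>t \<in> S\<close>, rotated]) (use \<theta> in auto)
qed

section \<open>The flow of the covector norm\<close>

text \<open>Uniqueness is asked of the end point only, because integral curves are unconstrained off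
  the time segment and so are never unique as functions.\<close>

lemma ham_flow_eqI:
  assumes "integral_curve k D (closed_segment 0 t) \<gamma>" "\<gamma> 0 = \<rho>"
    and "\<And>\<delta>. \<lbrakk>integral_curve k D (closed_segment 0 t) \<delta>; \<delta> 0 = \<rho>\<rbrakk> \<Longrightarrow> \<delta> t = \<gamma> t"
  shows "ham_flow k D t \<rho> = \<gamma> t"
  unfolding ham_flow_def using assms by (intro the_equality) blast+

lemma ham_field_covector_norm:
  assumes "\<xi> \<noteq> 0"
  shows "ham_field covector_norm (x, \<xi>) = (sgn \<xi>, 0)"
proof -
  have "((\<lambda>\<eta>. \<bar>\<eta>\<bar>) has_real_derivative sgn \<xi>) (at \<xi>)"
    using GDERIV_norm[OF assms] by simp
  then show ?thesis
    by (simp add: ham_field_def covector_norm_def circle_deriv_def DERIV_imp_deriv)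
qed

text \<open>Off the zero section the field is \<open>(sgn \<xi>, 0)\<close>. A competing curve
  therefore first has constant momentum, and then constant base velocity \<open>sgn \<xi>\<close>,
  which determines its lift.\<close>

lemma ham_flow_covector_norm:
  assumes "\<xi> \<noteq> 0" "0 \<le> t"
  shows "ham_flow covector_norm (- zero_section) t (circ x, \<xi>) = (circ (x + sgn \<xi> * t), \<xi>)"
proof -
  let ?S = "closed_segment 0 t" and ?X = "\<lambda>s. x + sgn \<xi> * s"
  have X: "(?X has_real_derivative sgn \<xi>) (at s within ?S)" for s
    by (auto intro!: derivative_eq_intros)
  have "ham_flow covector_norm (- zero_section) t (circ x, \<xi>) = (\<lambda>s. (circ (?X s), \<xi>)) t"
  proof (rule ham_flow_eqI)
    show "integral_curve covector_norm (- zero_section) ?S (\<lambda>s. (circ (?X s), \<xi>))"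
      using assms X
      by (auto simp: integral_curve_def ham_field_covector_norm zero_section_def
          intro!: circle_velocityI[where \<theta> = ?X])
  next
    fix \<delta>
    assume \<delta>: "integral_curve covector_norm (- zero_section) ?S \<delta>" and init: "\<delta> 0 = (circ x, \<xi>)"
    have field: "ham_field covector_norm (\<delta> s) = (sgn (snd (\<delta> s)), 0)" if "s \<in> ?S" for s
      using \<delta> that ham_field_covector_norm[of "snd (\<delta> s)" "fst (\<delta> s)"]
      by (simp add: integral_curve_def zero_section_def)
    have "((\<lambda>s. snd (\<delta> s)) has_real_derivative 0) (at s within ?S)" if "s \<in> ?S" for s
    proof -
      have "((\<lambda>s. snd (\<delta> s)) has_real_derivative snd (ham_field covector_norm (\<delta> s))) (at s within ?S)"
        using \<delta> that unfolding integral_curve_def by blast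
      with field[OF that] show ?thesis
        by simp
    qed
    then have snd: "snd (\<delta> s) = \<xi>" if "s \<in> ?S" for s
      using has_real_derivative_zero_imp_eq[of ?S "\<lambda>s. snd (\<delta> s)" s 0] init that by simp
    have "circle_velocity (\<lambda>s. fst (\<delta> s)) (sgn \<xi>) s ?S" if "s \<in> ?S" for s
    proof -
      have "circle_velocity (\<lambda>s. fst (\<delta> s)) (fst (ham_field covector_norm (\<delta> s))) s ?S"
        using \<delta> that unfolding integral_curve_def by blast
      with field[OF that] snd[OF that] show ?thesis
        by simp
    qed
    from circle_velocity_lift[OF _ this X, of 0 t] init have "fst (\<delta> t) = circ (?X t)"
      by simp
    with snd[of t] show "\<delta> t = (circ (?X t), \<xi>)"
      by (simp add: prod_eq_iff)
  qed simp
  then show ?thesis .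
qed

text \<open>The base point moves at unit speed on a circle of length 1, so it meets any given point
  of \<open>\<omega>\<close> at some time in (0, 1].\<close>

lemma GCC_if_nonempty:
  assumes "\<omega> \<noteq> {}" "1 < T"
  shows "GCC \<omega> T"
  unfolding GCC_def
proof
  fix \<rho> assume "\<rho> \<in> cosphere"
  obtain y \<xi> where \<rho>: "\<rho> = (y, \<xi>)"
    by fastforce
  with \<open>\<rho> \<in> cosphere\<close> have \<xi>: "\<bar>\<xi>\<bar> = 1"
    by (simp add: cosphere_def covector_norm_def)
  then have sgn: "sgn \<xi> * sgn \<xi> = 1" and "\<xi> \<noteq> 0"
    by (auto simp: sgn_if)
  obtain z where "z \<in> \<omega>"
    using \<open>\<omega> \<noteq> {}\<close> by blast
  define x where "x = rep_circle y"
  \<comment> \<open>\<open>w\<close> is the displacement to the target, counted in the direction of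
    motion. Its fractional part is the arrival time, except that the value 0 is replaced by a full
    turn because control times are positive.\<close>
  define w where "w = sgn \<xi> * (rep_circle z - x)"
  define t where "t = (if frac w = 0 then 1 else frac w)"
  have t: "t \<in> {0<..<T}"
    using \<open>1 < T\<close> frac_lt_1[of w] frac_ge_0[of w] by (auto simp: t_def)
  have "t - w \<in> \<int>"
    by (cases "w \<in> \<int>") (simp_all add: t_def frac_eq_0_iff, simp add: frac_def)
  then have "sgn \<xi> * (t - w) \<in> \<int>"
    by (intro Ints_mult) (auto simp: sgn_if)
  moreover have "sgn \<xi> * w = rep_circle z - x"
    using sgn by (simp add: w_def flip: mult.assoc)
  then have "sgn \<xi> * (t - w) = x + sgn \<xi> * t - rep_circle z"
    by (simp add: right_diff_distrib)
  ultimately have "circ (x + sgn \<xi> * t) = circ (rep_circle z)"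
    by (simp add: circ_eq_iff)
  then have "fst (ham_flow covector_norm (- zero_section) t \<rho>) = z"
    using t \<open>\<xi> \<noteq> 0\<close> ham_flow_covector_norm[of \<xi> t x]
    by (simp add: \<rho> x_def circ_rep_circle)
  with t \<open>z \<in> \<omega>\<close> show "\<exists>t\<in>{0<..<T}. fst (ham_flow covector_norm (- zero_section) t \<rho>) \<in> \<omega>"
    by blast
qed

section \<open>The flow of \<open>q\<close>\<close>

lemma q_symbol_sq: "V x > 0 \<Longrightarrow> (q_symbol V (x, \<xi>))\<^sup>2 = \<xi>\<^sup>2 + V x"
  and q_symbol_pos: "V x > 0 \<Longrightarrow> q_symbol V (x, \<xi>) > 0"
  by (simp_all add: q_symbol_def covector_norm_def add_nonneg_pos)

section \<open>Regularity of the potential and the Hamiltonian field of \<open>q\<close>\<close>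

locale positive_potential =
  fixes V :: "circle \<Rightarrow> real"
  assumes smooth: "smooth_circle V" and pos: "V x > 0"
begin

abbreviation "V' \<equiv> circle_deriv V"

lemma differentiable_V: "(\<lambda>s. V (circ s)) differentiable (at s)"
  using smooth unfolding smooth_circle_def by (metis funpow_0)

lemma differentiable_V': "(\<lambda>s. V' (circ s)) differentiable (at s)"
proof -
  have "(deriv ^^ 1) (\<lambda>s. V (circ s)) differentiable (at s)"
    using smooth unfolding smooth_circle_def by blast
  then show ?thesis
    unfolding circle_deriv_circ by simp
qed

lemma differentiable_V'': "(\<lambda>s. circle_deriv V' (circ s)) differentiable (at s)"
proof -
  have "(deriv ^^ 2) (\<lambda>s. V (circ s)) differentiable (at s)"
    using smooth unfolding smooth_circle_def by blast
  then show ?thesis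
    unfolding circle_deriv_circ by (simp add: numeral_2_eq_2)
qed

lemma DERIV_V: "((\<lambda>s. V (circ s)) has_real_derivative V' (circ s)) (at s)"
  using differentiable_V by (simp add: circle_deriv_circ DERIV_deriv_iff_real_differentiable)

lemma DERIV_V': "((\<lambda>s. V' (circ s)) has_real_derivative circle_deriv V' (circ s)) (at s)"
  using differentiable_V'
  by (subst circle_deriv_circ) (simp add: DERIV_deriv_iff_real_differentiable)

lemma continuous_V: "continuous_on UNIV (\<lambda>s. V (circ s))"
  by (intro continuous_at_imp_continuous_on ballI differentiable_imp_continuous_within differentiable_V)

lemma continuous_V': "continuous_on UNIV (\<lambda>s. V' (circ s))"
  by (intro continuous_at_imp_continuous_on ballI differentiable_imp_continuous_within differentiable_V')

lemma continuous_V'': "continuous_on UNIV (\<lambda>s. circle_deriv V' (circ s))"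
  by (intro continuous_at_imp_continuous_on ballI differentiable_imp_continuous_within differentiable_V'')

text \<open>The second derivative of \<open>V\<close> is continuous and periodic, hence bounded.
  This is what makes the equations of motion at fixed energy globally Lipschitz.\<close>

lemma lipschitz_V': obtains L where "L-lipschitz_on UNIV (\<lambda>s. V' (circ s))"
proof -
  have "continuous_on UNIV (\<lambda>s. \<bar>circle_deriv V' (circ s)\<bar>)"
    by (intro continuous_intros continuous_V'')
  then obtain B where "B > 0" and B: "\<And>x. \<bar>circle_deriv V' x\<bar> \<le> B"
    by (rule continuous_circle_bounded_above) blast
  have "B-lipschitz_on UNIV (\<lambda>s. V' (circ s))"
  proof (rule bounded_derivative_imp_lipschitz)
    show "((\<lambda>s. V' (circ s)) has_derivative (*) (circle_deriv V' (circ s))) (at s within UNIV)" for s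
      using DERIV_V' by (simp add: has_field_derivative_def)
    show "onorm ((*) (circle_deriv V' (circ s))) \<le> B" for s
      using B[of "circ s"] by (intro onorm_le) (simp add: abs_mult mult_right_mono)
  qed (use \<open>B > 0\<close> in auto)
  then show thesis ..
qed

lemma ham_field_q_symbol:
  "ham_field (q_symbol V) (x, \<xi>) = (\<xi> / q_symbol V (x, \<xi>), - V' x / (2 * q_symbol V (x, \<xi>)))"
proof -
  define s where "s = rep_circle x"
  then have x: "x = circ s"
    by (simp add: circ_rep_circle)
  have *: "\<xi>\<^sup>2 + V x > 0" for \<xi> x
    using pos[of x] by (simp add: add_nonneg_pos)
  have "((\<lambda>\<eta>. q_symbol V (x, \<eta>)) has_real_derivative \<xi> / q_symbol V (x, \<xi>)) (at \<xi>)"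
    unfolding q_symbol_def covector_norm_def using *[of \<xi> x]
    by (auto intro!: derivative_eq_intros simp: field_simps)
  moreover have "((\<lambda>r. q_symbol V (circ r, \<xi>)) has_real_derivative V' x / (2 * q_symbol V (x, \<xi>))) (at s)"
    unfolding q_symbol_def covector_norm_def x using *[of \<xi> "circ s"]
    by (auto intro!: derivative_eq_intros DERIV_V simp: field_simps)
  ultimately show ?thesis
    by (simp add: ham_field_def x circle_deriv_circ[of "\<lambda>y. q_symbol V (y, \<xi>)"] DERIV_imp_deriv)
qed

section \<open>The reduced system on an energy level\<close>

text \<open>The Hamiltonian field of \<open>q\<close>, lifted to the plane, with the denominator
  \<open>q\<close> frozen at the constant \<open>E\<close>. On the level \<open>q = E\<close> the
  two fields agree.\<close>

definition reduced_field :: "real \<Rightarrow> real \<times> real \<Rightarrow> real \<times> real" where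
  "reduced_field E p = (snd p / E, - V' (circ (fst p)) / (2 * E))"

lemma lipschitz_reduced_field: obtains L where "L-lipschitz_on UNIV (reduced_field E)"
proof -
  obtain L where L: "L-lipschitz_on UNIV (\<lambda>s. V' (circ s))"
    by (rule lipschitz_V')
  have fst: "1-lipschitz_on UNIV (fst :: real \<times> real \<Rightarrow> real)"
    and snd: "1-lipschitz_on UNIV (snd :: real \<times> real \<Rightarrow> real)"
    by (intro lipschitz_onI; simp only: mult_1 dist_fst_le dist_snd_le; simp)+
  have "(L * 1)-lipschitz_on UNIV (\<lambda>p :: real \<times> real. V' (circ (fst p)))"
    by (rule lipschitz_on_compose2[OF fst lipschitz_on_subset[OF L]]) simp
  from lipschitz_on_Pair[OF lipschitz_on_cmult_real[OF snd, of "1 / E"]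
      lipschitz_on_cmult_real[OF this, of "- 1 / (2 * E)"]]
  show thesis
    by (intro that) (simp add: reduced_field_def[abs_def])
qed

text \<open>The two contributions \<open>- \<Xi> * V' / E\<close> and \<open>V' * \<Xi> / E\<close>
  to the derivative cancel. A reduced solution that starts on the level \<open>q = E\<close> thus
  stays there and is a true Hamiltonian trajectory.\<close>

lemma reduced_energy_constant:
  assumes "E \<noteq> 0"
    and X: "\<And>s. s \<in> {0..T} \<Longrightarrow> (X has_real_derivative \<Xi> s / E) (at s within {0..T})"
    and \<Xi>: "\<And>s. s \<in> {0..T} \<Longrightarrow> (\<Xi> has_real_derivative - V' (circ (X s)) / (2 * E)) (at s within {0..T})"
    and t: "t \<in> {0..T}"
  shows "(\<Xi> t)\<^sup>2 + V (circ (X t)) = (\<Xi> 0)\<^sup>2 + V (circ (X 0))"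
proof -
  have "((\<lambda>s. (\<Xi> s)\<^sup>2 + V (circ (X s))) has_real_derivative 0) (at s within {0..T})"
    if s: "s \<in> {0..T}" for s
    using \<open>E \<noteq> 0\<close>
    by (auto intro!: derivative_eq_intros X \<Xi> s DERIV_chain2[OF DERIV_V] simp: field_simps)
  then show ?thesis
    by (rule has_real_derivative_zero_imp_eq[where S = "{0..T}"]) (use t in auto)
qed

text \<open>Uniqueness on the circle reduces to uniqueness on the line: \<open>q\<close> is conserved, so the base
  velocity \<open>\<xi> / q\<close> is continuous and its primitive lifts the base curve.\<close>

lemma integral_curve_q_symbol_unique:
  assumes \<delta>: "integral_curve (q_symbol V) UNIV {0..t} \<delta>" and init: "\<delta> 0 = (circ x0, \<xi>0)"
    and E: "E = q_symbol V (circ x0, \<xi>0)" and "0 \<le> t"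
    and X: "X 0 = x0" "\<And>s. s \<in> {0..t} \<Longrightarrow> (X has_real_derivative \<Xi> s / E) (at s within {0..t})"
    and \<Xi>: "\<Xi> 0 = \<xi>0"
      "\<And>s. s \<in> {0..t} \<Longrightarrow> (\<Xi> has_real_derivative - V' (circ (X s)) / (2 * E)) (at s within {0..t})"
  shows "\<delta> t = (circ (X t), \<Xi> t)"
proof -
  define c \<eta> where "c s = fst (\<delta> s)" and "\<eta> s = snd (\<delta> s)" for s
  have \<delta>_eq: "\<delta> s = (c s, \<eta> s)" for s
    by (simp add: c_def \<eta>_def)
  have q: "q_symbol V (\<delta> s) > 0" for s
    unfolding \<delta>_eq by (intro q_symbol_pos pos)
  have c: "circle_velocity c (\<eta> s / q_symbol V (\<delta> s)) s {0..t}"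
    and \<eta>: "(\<eta> has_real_derivative - V' (c s) / (2 * q_symbol V (\<delta> s))) (at s within {0..t})"
    if "s \<in> {0..t}" for s
  proof -
    have "circle_velocity (\<lambda>s. fst (\<delta> s)) (fst (ham_field (q_symbol V) (\<delta> s))) s {0..t} \<and>
      ((\<lambda>s. snd (\<delta> s)) has_real_derivative snd (ham_field (q_symbol V) (\<delta> s))) (at s within {0..t})"
      using \<delta> that unfolding integral_curve_def by blast
    then show "circle_velocity c (\<eta> s / q_symbol V (\<delta> s)) s {0..t}"
      "(\<eta> has_real_derivative - V' (c s) / (2 * q_symbol V (\<delta> s))) (at s within {0..t})"
      unfolding \<delta>_eq ham_field_q_symbol by simp_all
  qed
  \<comment> \<open>Conservation is derived with the varying denominator
    \<open>q_symbol V (\<delta> s)\<close>, which is common to both velocities and drops out; only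
    afterwards can it be replaced by \<open>E\<close>.\<close>
  have "((\<lambda>s. (\<eta> s)\<^sup>2 + V (c s)) has_real_derivative 0) (at s within {0..t})"
    if s: "s \<in> {0..t}" for s
    using q[of s]
    by (auto intro!: derivative_eq_intros \<eta>[OF s] circle_velocity_chain[OF c[OF s] s differentiable_V])
  then have "(\<eta> s)\<^sup>2 + V (c s) = (\<eta> 0)\<^sup>2 + V (c 0)" if "s \<in> {0..t}" for s
    by (rule has_real_derivative_zero_imp_eq[where S = "{0..t}"]) (use that in auto)
  then have energy: "q_symbol V (\<delta> s) = E" if "s \<in> {0..t}" for s
    using that init by (simp add: E \<delta>_eq q_symbol_def covector_norm_def)
  have "continuous_on {0..t} (\<lambda>s. \<eta> s / E)"
    using q[of 0] init \<eta>
    by (intro continuous_intros DERIV_continuous_on) (auto simp: E)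
  note primitive = integral_has_real_derivative[OF this]
  define Y where "Y s = x0 + integral {0..s} (\<lambda>s. \<eta> s / E)" for s
  have Y: "(Y has_real_derivative \<eta> s / E) (at s within {0..t})" if "s \<in> {0..t}" for s
    unfolding Y_def[abs_def] using DERIV_add[OF DERIV_const primitive[OF that], of x0] by simp
  have lift: "c s = circ (Y s)" if "s \<in> {0..t}" for s
  proof (rule circle_velocity_lift[of "{0..t}" c "\<lambda>s. \<eta> s / E" Y 0])
    show "c 0 = circ (Y 0)"
      using init by (simp add: Y_def c_def)
  qed (use c energy Y that \<open>0 \<le> t\<close> in auto)
  obtain L where "L-lipschitz_on UNIV (reduced_field E)"
    by (rule lipschitz_reduced_field)
  then have "(Y t, \<eta> t) = (X t, \<Xi> t)"
    using \<open>0 \<le> t\<close>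
  proof (rule lipschitz_ode_unique[where x = "\<lambda>s. (Y s, \<eta> s)" and y = "\<lambda>s. (X s, \<Xi> s)"])
    fix s assume s: "s \<in> {0..t}"
    show "((\<lambda>s. (Y s, \<eta> s)) has_vector_derivative reduced_field E (Y s, \<eta> s)) (at s within {0..t})"
      using Y[OF s] \<eta>[OF s] lift[OF s] energy[OF s]
      by (auto simp: reduced_field_def has_real_derivative_iff_has_vector_derivative
          intro!: has_vector_derivative_Pair)
    show "((\<lambda>s. (X s, \<Xi> s)) has_vector_derivative reduced_field E (X s, \<Xi> s)) (at s within {0..t})"
      using X(2)[OF s] \<Xi>(2)[OF s]
      by (auto simp: reduced_field_def has_real_derivative_iff_has_vector_derivative
          intro!: has_vector_derivative_Pair)
  next
    show "(Y 0, \<eta> 0) = (X 0, \<Xi> 0)"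
      using init X \<Xi> by (simp add: Y_def \<eta>_def)
  qed
  then show ?thesis
    using lift[of t] \<open>0 \<le> t\<close> by (simp add: \<delta>_eq)
qed

text \<open>Any solution of the reduced system computes the flow: conservation of energy makes it an
  integral curve, and every other integral curve with the same start has the same end point.\<close>

lemma ham_flow_q_symbol_eq:
  assumes E: "E = q_symbol V (circ (X 0), \<Xi> 0)"
    and X: "\<And>s. s \<in> {0..T} \<Longrightarrow> (X has_real_derivative \<Xi> s / E) (at s within {0..T})"
    and \<Xi>: "\<And>s. s \<in> {0..T} \<Longrightarrow> (\<Xi> has_real_derivative - V' (circ (X s)) / (2 * E)) (at s within {0..T})"
    and t: "t \<in> {0..T}"
  shows "ham_flow (q_symbol V) UNIV t (circ (X 0), \<Xi> 0) = (circ (X t), \<Xi> t)"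
proof -
  have seg: "closed_segment 0 t = {0..t}"
    using t by (simp add: closed_segment_eq_real_ivl)
  have "E > 0"
    unfolding E by (intro q_symbol_pos pos)
  have energy: "q_symbol V (circ (X s), \<Xi> s) = E" if "s \<in> {0..T}" for s
    using reduced_energy_constant[OF _ X \<Xi> that] \<open>E > 0\<close>
    by (simp add: E q_symbol_def covector_norm_def)
  have X': "(X has_real_derivative \<Xi> s / E) (at s within {0..t})"
    and \<Xi>': "(\<Xi> has_real_derivative - V' (circ (X s)) / (2 * E)) (at s within {0..t})"
    if "s \<in> {0..t}" for s
    using t that X[of s] \<Xi>[of s] by (auto elim: DERIV_subset)
  have "ham_flow (q_symbol V) UNIV t (circ (X 0), \<Xi> 0) = (\<lambda>s. (circ (X s), \<Xi> s)) t"
  proof (rule ham_flow_eqI)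
    show "integral_curve (q_symbol V) UNIV (closed_segment 0 t) (\<lambda>s. (circ (X s), \<Xi> s))"
      using X' \<Xi>' t energy
      by (auto simp: integral_curve_def seg ham_field_q_symbol intro!: circle_velocityI[where \<theta> = X])
    show "\<delta> t = (circ (X t), \<Xi> t)"
      if "integral_curve (q_symbol V) UNIV (closed_segment 0 t) \<delta>" "\<delta> 0 = (circ (X 0), \<Xi> 0)" for \<delta>
      using integral_curve_q_symbol_unique[OF that[unfolded seg] E _ refl X' refl \<Xi>'] t by auto
  qed simp
  then show ?thesis .
qed

lemma reduced_solution_exists:
  assumes "0 \<le> T"
  obtains X \<Xi> where "X 0 = x0" "\<Xi> 0 = \<xi>0"
    and "\<And>s. s \<in> {0..T} \<Longrightarrow> (X has_real_derivative \<Xi> s / E) (at s within {0..T})"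
    and "\<And>s. s \<in> {0..T} \<Longrightarrow> (\<Xi> has_real_derivative - V' (circ (X s)) / (2 * E)) (at s within {0..T})"
proof -
  obtain L where "L-lipschitz_on UNIV (reduced_field E)"
    by (rule lipschitz_reduced_field)
  then obtain \<gamma> where \<gamma>0: "\<gamma> 0 = (x0, \<xi>0)"
    and \<gamma>: "\<And>t. t \<in> {0..T} \<Longrightarrow> (\<gamma> has_vector_derivative reduced_field E (\<gamma> t)) (at t within {0..T})"
    using \<open>0 \<le> T\<close> by (rule lipschitz_ode_exists[where ?x0.0 = "(x0, \<xi>0)"]) blast
  show thesis
  proof (rule that[of "\<lambda>t. fst (\<gamma> t)" "\<lambda>t. snd (\<gamma> t)"])
    fix s assume "s \<in> {0..T}"
    from bounded_linear.has_vector_derivative[OF bounded_linear_fst \<gamma>[OF this]]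
      bounded_linear.has_vector_derivative[OF bounded_linear_snd \<gamma>[OF this]]
    show "((\<lambda>t. fst (\<gamma> t)) has_real_derivative snd (\<gamma> s) / E) (at s within {0..T})"
      "((\<lambda>t. snd (\<gamma> t)) has_real_derivative - V' (circ (fst (\<gamma> s))) / (2 * E)) (at s within {0..T})"
      by (simp_all add: reduced_field_def has_real_derivative_iff_has_vector_derivative)
  qed (use \<gamma>0 in auto)
qed

text \<open>With zero momentum and vanishing \<open>V'\<close> the constant curve solves the reduced
  system.\<close>

lemma ham_flow_critical_point:
  assumes "critical_point V x" "0 \<le> t"
  shows "ham_flow (q_symbol V) UNIV t (x, 0) = (x, 0)"
  using ham_flow_q_symbol_eq[of "q_symbol V (x, 0)" "\<lambda>_. rep_circle x" "\<lambda>_. 0" t t] assms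
  by (simp add: critical_point_def circ_rep_circle)

section \<open>Control when \<open>\<omega>\<close> contains the critical points\<close>

text \<open>The representatives in \<open>{0..1}\<close> of points off \<open>\<omega>\<close> form
  a compact set, on which the absolute value of \<open>V'\<close> attains its minimum, if there are
  any; the minimum is not 0 since no critical point lies there.\<close>

lemma circle_deriv_bounded_below:
  assumes "open \<omega>" "{x. critical_point V x} \<subseteq> \<omega>"
  obtains c where "c > 0" "\<And>x. x \<notin> \<omega> \<Longrightarrow> c \<le> \<bar>V' x\<bar>"
proof -
  define K where "K = {0..1} - circ -` \<omega>"
  have "compact K"
    using assms(1) by (auto simp: K_def open_circle_def intro!: compact_diff)
  have "\<exists>c>0. \<forall>s\<in>K. c \<le> \<bar>V' (circ s)\<bar>"
  proof (cases "K = {}")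
    case False
    have "continuous_on K (\<lambda>s. \<bar>V' (circ s)\<bar>)"
      by (intro continuous_intros continuous_on_subset[OF continuous_V']) auto
    from continuous_attains_inf[OF \<open>compact K\<close> False this]
    obtain m where m: "m \<in> K" "\<forall>s\<in>K. \<bar>V' (circ m)\<bar> \<le> \<bar>V' (circ s)\<bar>"
      by blast
    then have "V' (circ m) \<noteq> 0"
      using assms(2) by (auto simp: K_def critical_point_def)
    with m show ?thesis
      by (intro exI[of _ "\<bar>V' (circ m)\<bar>"]) auto
  qed (auto intro: exI[of _ 1])
  then obtain c where "c > 0" and c: "\<And>s. s \<in> K \<Longrightarrow> c \<le> \<bar>V' (circ s)\<bar>"
    by blast
  show thesis
  proof (rule that[OF \<open>c > 0\<close>])
    fix x assume "x \<notin> \<omega>"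
    obtain a where "0 \<le> a" "a \<le> 1" "x = circ a"
      by (rule circ_surj_01)
    with \<open>x \<notin> \<omega>\<close> c[of a] show "c \<le> \<bar>V' x\<bar>"
      by (simp add: K_def)
  qed
qed

end

lemma has_real_derivative_mvt:
  fixes f f' :: "real \<Rightarrow> real"
  assumes "\<And>s. s \<in> {0..T} \<Longrightarrow> (f has_real_derivative f' s) (at s within {0..T})"
    and "0 \<le> a" "a \<le> b" "b \<le> T"
  obtains s where "s \<in> {a..b}" "f b - f a = f' s * (b - a)"
proof -
  have "(f has_derivative (*) (f' s)) (at s within {a..b})" if "a \<le> s" "s \<le> b" for s
    using assms(1)[of s] assms(2-) that
    by (auto simp: has_field_derivative_def elim!: has_derivative_subset)
  from mvt_very_simple[OF \<open>a \<le> b\<close> this] show thesis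
    using that by blast
qed

text \<open>Starting from the smaller end value \<open>m\<close>, the path values cover the whole
  interval from \<open>m\<close> to \<open>m + 1\<close>, which contains a representative of every
  point of the circle.\<close>

lemma real_path_hits_circle_point:
  fixes X :: "real \<Rightarrow> real"
  assumes "continuous_on {a..b} X" "a \<le> b" "1 \<le> \<bar>X b - X a\<bar>"
  obtains t where "t \<in> {a..b}" "circ (X t) = z"
proof -
  define m where "m = min (X a) (X b)"
  define y where "y = m + frac (rep_circle z - m)"
  have "y - rep_circle z \<in> \<int>"
    by (simp add: y_def frac_def)
  then have "circ y = z"
    by (metis circ_eq_iff circ_rep_circle)
  have "m \<le> y" "y \<le> m + 1"
    using frac_lt_1[of "rep_circle z - m"] by (auto simp: y_def)
  then have "X a \<le> y \<and> y \<le> X b \<or> X b \<le> y \<and> y \<le> X a"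
    using assms(3) by (auto simp: m_def min_def split: if_splits)
  then obtain t where "a \<le> t" "t \<le> b" "X t = y"
    using IVT'[of X a y b] IVT2'[of X b y a] assms(1,2) by blast
  with \<open>circ y = z\<close> that show thesis
    by auto
qed

context positive_potential begin

text \<open>Energies are split at \<open>E\<^sup>2 = 2 * B\<close>. Above the threshold a time
  window of length 2 suffices for a full turn; below it the time bound
  \<open>4 * E\<^sup>2 / c\<close> is uniform because \<open>E\<^sup>2 < 2 * B\<close>.\<close>

lemma GCC_V_if_critical_subset:
  assumes "open \<omega>" "{x. critical_point V x} \<subseteq> \<omega>"
  obtains T where "T > 1" "GCC_V V \<omega> T"
proof -
  obtain c where "c > 0" and c: "\<And>x. x \<notin> \<omega> \<Longrightarrow> c \<le> \<bar>V' x\<bar>"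
    by (rule circle_deriv_bounded_below[OF assms]) blast
  obtain B where "B > 0" and B: "\<And>x. V x \<le> B"
    by (rule continuous_circle_bounded_above[OF continuous_V]) blast
  obtain z where "z \<in> \<omega>"
    using circle_critical_point_exists[of V] differentiable_V assms(2) by blast
  \<comment> \<open>The low-energy case is contradicted once \<open>c * (T - 2)\<close> is at least
    \<open>8 * B\<close>. The surplus gives \<open>T > 4\<close>, so that the closed windows
    \<open>{1..3}\<close> and \<open>{1..T - 1}\<close> lie strictly between 0 and \<open>T\<close>,
    where the trajectory is known to avoid \<open>\<omega>\<close>.\<close>
  define T where "T = 8 * B / c + 5"
  have "T > 4"
    using \<open>B > 0\<close> \<open>c > 0\<close> by (simp add: T_def add_pos_pos)
  have "\<exists>t\<in>{0<..<T}. fst (ham_flow (q_symbol V) UNIV t (y, \<xi>)) \<in> \<omega>" for y \<xi>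
  proof (rule ccontr)
    assume contra: "\<not> ?thesis"
    define E where "E = q_symbol V (y, \<xi>)"
    have "E > 0"
      unfolding E_def by (intro q_symbol_pos pos)
    obtain X \<Xi> where init: "X 0 = rep_circle y" "\<Xi> 0 = \<xi>"
      and X: "\<And>s. s \<in> {0..T} \<Longrightarrow> (X has_real_derivative \<Xi> s / E) (at s within {0..T})"
      and \<Xi>: "\<And>s. s \<in> {0..T} \<Longrightarrow> (\<Xi> has_real_derivative - V' (circ (X s)) / (2 * E)) (at s within {0..T})"
      using reduced_solution_exists[of T "rep_circle y" \<xi> E] \<open>T > 4\<close> by auto
    have E: "E = q_symbol V (circ (X 0), \<Xi> 0)"
      by (simp add: E_def init circ_rep_circle)
    have outside: "circ (X t) \<notin> \<omega>" if "0 < t" "t < T" for t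
      using contra that ham_flow_q_symbol_eq[OF E X \<Xi>, of t]
      by (force simp: init circ_rep_circle)
    have energy: "(\<Xi> t)\<^sup>2 + V (circ (X t)) = E\<^sup>2" if "t \<in> {0..T}" for t
      using reduced_energy_constant[OF _ X \<Xi> that] \<open>E > 0\<close> by (simp add: E q_symbol_sq pos)
    show False
    proof (cases "2 * B \<le> E\<^sup>2")
      case True
      have speed: "1 / 2 \<le> \<bar>\<Xi> t / E\<bar>" if "t \<in> {0..T}" for t
      proof -
        \<comment> \<open>The potential uses up at most half of \<open>E\<^sup>2\<close>, so the
          squared momentum is at least \<open>E\<^sup>2 / 2\<close>, which exceeds the required
          quarter.\<close>
        have "(E / 2)\<^sup>2 \<le> (\<Xi> t)\<^sup>2"
          using energy[OF that] B[of "circ (X t)"] True \<open>B > 0\<close> by (simp add: power_divide)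
        then have "E / 2 \<le> \<bar>\<Xi> t\<bar>"
          using \<open>E > 0\<close> by (simp add: abs_le_square_iff[symmetric])
        then show ?thesis
          using \<open>E > 0\<close> by (simp add: field_simps)
      qed
      \<comment> \<open>Speed at least 1/2 during a time 2 gives a displacement of at least one full
        turn, which passes over \<open>z\<close>.\<close>
      obtain s where "s \<in> {1..3}" "X 3 - X 1 = \<Xi> s / E * (3 - 1)"
        using has_real_derivative_mvt[OF X, of 1 3] \<open>T > 4\<close> by auto
      then have "1 \<le> \<bar>X 3 - X 1\<bar>"
        using speed[of s] \<open>T > 4\<close> by (simp add: abs_mult)
      moreover have "continuous_on {1..3} X"
        using DERIV_continuous_on[OF X] by (rule continuous_on_subset) (use \<open>T > 4\<close> in auto)
      ultimately obtain t where "t \<in> {1..3}" "circ (X t) = z"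
        using real_path_hits_circle_point[of 1 3 X z] by auto
      with outside[of t] \<open>z \<in> \<omega>\<close> \<open>T > 4\<close> show False
        by auto
    next
      case False
      have bound: "\<bar>\<Xi> t\<bar> \<le> E" if "t \<in> {0..T}" for t
        using energy[OF that] pos[of "circ (X t)"] \<open>E > 0\<close> abs_le_square_iff[of "\<Xi> t" E] by simp
      \<comment> \<open>The mean value theorem yields the total momentum change from the force at a
        single time, so the sign of \<open>V'\<close> along the path need not be tracked.\<close>
      obtain s where s: "s \<in> {1..T - 1}"
        and eq: "\<Xi> (T - 1) - \<Xi> 1 = - V' (circ (X s)) / (2 * E) * (T - 1 - 1)"
        using has_real_derivative_mvt[OF \<Xi>, of 1 "T - 1"] \<open>T > 4\<close> by auto
      have "c / (2 * E) * (T - 2) \<le> \<bar>V' (circ (X s))\<bar> / (2 * E) * (T - 2)"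
        using c[OF outside[of s]] s \<open>E > 0\<close> \<open>T > 4\<close>
        by (intro mult_right_mono divide_right_mono) auto
      also have "\<dots> = \<bar>\<Xi> (T - 1) - \<Xi> 1\<bar>"
        unfolding eq using \<open>E > 0\<close> \<open>T > 4\<close> by (simp add: abs_mult)
      also have "\<dots> \<le> 2 * E"
        using bound[of 1] bound[of "T - 1"] \<open>T > 4\<close> by auto
      finally have "c * (T - 2) \<le> 4 * E\<^sup>2"
        using \<open>E > 0\<close> by (simp add: field_simps power2_eq_square)
      also have "\<dots> < 8 * B"
        using False by simp
      finally show False
        using \<open>c > 0\<close> by (simp add: T_def field_simps)
    qed
  qed
  then have "GCC_V V \<omega> T"
    by (simp add: GCC_V_def split_paired_all)
  with \<open>T > 4\<close> show thesis
    by (intro that) auto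
qed

end

theorem proposition1p6:
  fixes V :: "circle \<Rightarrow> real" and \<omega> :: "circle set"
  assumes "smooth_circle V"
    and "\<And>x. V x > 0"
    and "linf_norm V = 1"
    and "open \<omega>"
  shows "(\<exists>T>0. GCC_V_plus V \<omega> T) \<longleftrightarrow> {x. critical_point V x} \<subseteq> \<omega>"
proof -
  interpret positive_potential V
    by unfold_locales (use assms in auto)
  show ?thesis
  proof
    assume "\<exists>T>0. GCC_V_plus V \<omega> T"
    then obtain T where T: "GCC_V V \<omega> T"
      by (auto simp: GCC_V_plus_def)
    show "{x. critical_point V x} \<subseteq> \<omega>"
    proof clarify
      fix x assume "critical_point V x"
      moreover obtain t where "t \<in> {0<..<T}" "fst (ham_flow (q_symbol V) UNIV t (x, 0)) \<in> \<omega>"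
        using T unfolding GCC_V_def by blast
      ultimately show "x \<in> \<omega>"
        by (simp add: ham_flow_critical_point)
    qed
  next
    assume sub: "{x. critical_point V x} \<subseteq> \<omega>"
    with \<open>open \<omega>\<close> obtain T where "T > 1" "GCC_V V \<omega> T"
      by (rule GCC_V_if_critical_subset)
    \<comment> \<open>Together with \<open>T > 1\<close>, nonemptiness lets the same
      \<open>T\<close> serve for the flow of the covector norm.\<close>
    moreover have "\<omega> \<noteq> {}"
      using circle_critical_point_exists[of V] differentiable_V sub by blast
    ultimately show "\<exists>T>0. GCC_V_plus V \<omega> T"
      by (intro exI[of _ T]) (simp add: GCC_V_plus_def GCC_if_nonempty)
  qed
qed

end
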